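(* For every integer $m\geq 1$, the space $\mathcal{C}_m(\mathbb{A})$ of all unions of at most $m$ non-empty closed intervals of the double arrow space $\mathbb{A}$, with the (subspace) Vietoris topology, is not homogeneous.
   Context: Double arrow space: let $\mathbb{A}_0={]}0,1]\times\{0\}$, $\mathbb{A}_1=[0,1{[}\times\{1\}$ (intervals of reals) and $\mathbb{A}=\mathbb{A}_0\cup\mathbb{A}_1$, ordered lexicographically: $\langle a,r\rangle\prec\langle b,s\rangle$ iff $a<b$, or $a=b$ and $r<s$. $\mathbb{A}$ carries the order topology. Vietoris topology: for a space $X$, $\operatorname{Exp}(X)$ is the set of all non-empty closed subsets of $X$, with the topology generated by the subbase of all sets $[V]=\{F\in\operatorname{Exp}(X):F\subset V\}$ and $\langle V\rangle=\{F\in\operatorname{Exp}(X):F\cap V\neq\emptyset\}$, $V$ a non-empty open subset of $X$. $\mathcal{C}_m(\mathbb{A})\subset\operatorname{Exp}(\mathbb{A})$ is the subspace of all unions of at most $m$ non-empty closed intervals $[a,b]=\{z\in\mathbb{A}:a\preceq z\preceq b\}$ ($a\preceq b$ in $\mathbb{A}$). A topological space $Y$ is homogeneous if for all $x,y\in Y$ there is a homeomorphism $h:Y\to Y$ with $h(x)=y$. *)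

theory Defs
  imports "HOL-Analysis.Abstract_Topology"
begin

text \<open>The double arrow space, as a type, so that its closed intervals \<open>{a..b}\<close> and its order
  topology are those of the library.\<close>

typedef double_arrow = "({0<..1} \<times> {0}) \<union> ({0..<1} \<times> {1}) :: (real \<times> nat) set"
  by (rule exI[of _ "(1, 0)"]) simp

instantiation double_arrow :: linorder
begin

definition less_double_arrow :: "double_arrow \<Rightarrow> double_arrow \<Rightarrow> bool" where
  "less_double_arrow x y \<longleftrightarrow>
     fst (Rep_double_arrow x) < fst (Rep_double_arrow y) \<or>
     fst (Rep_double_arrow x) = fst (Rep_double_arrow y) \<and>
     snd (Rep_double_arrow x) < snd (Rep_double_arrow y)"

definition less_eq_double_arrow :: "double_arrow \<Rightarrow> double_arrow \<Rightarrow> bool" where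
  "less_eq_double_arrow x y \<longleftrightarrow> x < y \<or> x = y"

instance
proof
  fix x y :: double_arrow
  have "x = y" if "fst (Rep_double_arrow x) = fst (Rep_double_arrow y)"
    "snd (Rep_double_arrow x) = snd (Rep_double_arrow y)"
    using that by (simp add: Rep_double_arrow_inject[symmetric] prod_eq_iff)
  then show "x \<le> y \<or> y \<le> x"
    unfolding less_eq_double_arrow_def less_double_arrow_def by fastforce
qed (auto simp: less_eq_double_arrow_def less_double_arrow_def)

end

instantiation double_arrow :: linorder_topology
begin

definition open_double_arrow :: "double_arrow set \<Rightarrow> bool" where
  "open_double_arrow =
     generate_topology (range (\<lambda>a. {..<a}) \<union> range (\<lambda>a. {a<..}))"

instance
  by standard (simp add: open_double_arrow_def)

end

definition Exp :: "'a topology \<Rightarrow> 'a set set" where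
  "Exp X = {F. closedin X F \<and> F \<noteq> {}}"

text \<open>The subbasic set given by \<open>V = topspace X\<close> is all of \<open>Exp X\<close>, so \<open>Exp X\<close> is the underlying
  set of this topology.\<close>

definition vietoris :: "'a topology \<Rightarrow> 'a set topology" where
  "vietoris X = topology_generated_by
     ({{F \<in> Exp X. F \<subseteq> V} | V. openin X V \<and> V \<noteq> {}} \<union>
      {{F \<in> Exp X. F \<inter> V \<noteq> {}} | V. openin X V \<and> V \<noteq> {}})"

text \<open>The family of intervals is required to be non-empty, since the empty set is not a point of
  the Vietoris space.\<close>

definition interval_unions :: "nat \<Rightarrow> 'a::order set set" where
  "interval_unions m =
     {\<Union>\<I> | \<I>. finite \<I> \<and> \<I> \<noteq> {} \<and> card \<I> \<le> m \<and> (\<forall>I\<in>\<I>. \<exists>a b. a \<le> b \<and> I = {a..b})}"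

definition interval_union_space :: "nat \<Rightarrow> 'a::linorder_topology set topology" where
  "interval_union_space m = subtopology (vietoris euclidean) (interval_unions m)"

definition homogeneous_space :: "'a topology \<Rightarrow> bool" where
  "homogeneous_space Y \<longleftrightarrow>
     (\<forall>x\<in>topspace Y. \<forall>y\<in>topspace Y. \<exists>h. homeomorphic_map Y Y h \<and> h x = y)"

end

theory Submission
  imports Defs "HOL-Analysis.Function_Topology"
begin

text \<open>
  If the space were homogeneous, a homeomorphism \<open>h\<close> would carry the singleton of the least point
  to a union of \<open>m\<close> intervals whose \<open>2m\<close> endpoints move independently in disjoint clopen cells.
  For each irrational \<open>x\<close> in a small interval, the pair \<open>{x\<^sup>-, x\<^sup>+}\<close> is then sent to such a union,
  with endpoint vector \<open>p x\<close>. The clopen families of all \<open>G \<subseteq> E\<close>, with \<open>E\<close> a ray cut at a rational,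
  separate \<open>{x\<^sup>-, x\<^sup>+}\<close> from everything except its subsets. By compactness of the product of the
  cells, these families, transported by \<open>h\<close>, ignore moving an endpoint across its gap, unless its real
  value lies in a fixed countable set \<open>Q\<close>. So moving all other endpoints of \<open>p x\<close> across their gaps
  yields the image of a non-empty subset \<open>G x\<close> of \<open>{x\<^sup>-, x\<^sup>+}\<close>. Now the pairs are isolated from each
  other, which makes the vectors \<open>p x\<close> avoid each other's one-sided neighbourhoods. After the move the
  neighbourhoods point the opposite way, so uncountably many of the moved vectors are isolated from
  each other as well. The sets \<open>G x\<close> are essentially singletons \<open>{x\<^sup>-}\<close> or \<open>{x\<^sup>+}\<close>, and an
  uncountable family of these cannot be discrete.\<close>

section \<open>The double arrow space\<close>

definition rv :: "double_arrow \<Rightarrow> real" where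
  "rv z = fst (Rep_double_arrow z)"

definition upper :: "double_arrow \<Rightarrow> bool" where
  "upper z \<longleftrightarrow> snd (Rep_double_arrow z) = 1"

text \<open>For \<open>t = 0\<close> without \<open>b\<close> and for \<open>t = 1\<close> with
  \<open>b\<close> there is no such point and the value is unspecified; hence the side conditions of
  \<open>rv_arrow\<close>.\<close>

definition arrow :: "bool \<Rightarrow> real \<Rightarrow> double_arrow" where
  "arrow b t = Abs_double_arrow (t, of_bool b)"

lemma Rep_double_arrow_cases:
  "0 < rv z \<and> rv z \<le> 1 \<and> snd (Rep_double_arrow z) = 0 \<or>
   0 \<le> rv z \<and> rv z < 1 \<and> snd (Rep_double_arrow z) = 1"
  using Rep_double_arrow[of z] by (auto simp: rv_def mem_Times_iff)

lemma rv_bounds: "0 \<le> rv z" "rv z \<le> 1" "upper z \<Longrightarrow> rv z < 1" "\<not> upper z \<Longrightarrow> 0 < rv z"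
  using Rep_double_arrow_cases[of z] by (auto simp: upper_def)

lemma
  assumes "0 \<le> t" "t \<le> 1" "if b then t < 1 else 0 < t"
  shows rv_arrow: "rv (arrow b t) = t" and upper_arrow: "upper (arrow b t) \<longleftrightarrow> b"
proof -
  have "Rep_double_arrow (arrow b t) = (t, of_bool b)"
    unfolding arrow_def using assms by (intro Abs_double_arrow_inverse) (cases b, auto)
  then show "rv (arrow b t) = t" "upper (arrow b t) \<longleftrightarrow> b"
    by (auto simp: rv_def upper_def)
qed

lemma arrow_less_iff: "z < w \<longleftrightarrow> rv z < rv w \<or> rv z = rv w \<and> \<not> upper z \<and> upper w"
  using Rep_double_arrow_cases[of z] Rep_double_arrow_cases[of w]
  by (auto simp: less_double_arrow_def rv_def upper_def)

lemma arrow_le_iff: "z \<le> w \<longleftrightarrow> rv z < rv w \<or> rv z = rv w \<and> (upper z \<longrightarrow> upper w)"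
  by (subst linorder_not_less[symmetric]) (auto simp: arrow_less_iff)

lemma arrow_eq_iff: "z = w \<longleftrightarrow> rv z = rv w \<and> upper z = upper w"
  using antisym[of z w] by (auto simp: arrow_le_iff)

text \<open>Every point is the endpoint of its cone, which is open because of the gap next to the point.\<close>

definition cone :: "double_arrow \<Rightarrow> double_arrow set" where
  "cone z = (if upper z then {z..} else {..z})"

text \<open>The cutoff \<open>r\<close> is an absolute real value, not a radius, so that different
  points can share it in the final pigeonhole argument. A cutoff on the wrong side of
  \<open>z\<close> makes the set empty, so \<open>z \<in> nb r z\<close> is required
  separately.\<close>

definition nb :: "real \<Rightarrow> double_arrow \<Rightarrow> double_arrow set" where
  "nb r z = {w \<in> cone z. if upper z then rv w < r else r < rv w}"

lemma open_cone: "open (cone z)"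
\<comment> \<open>Only the least and the greatest point have no partner across a gap; their cones
  are the whole space.\<close>
proof (cases "rv z = (if upper z then 0 else 1)")
  case True
  have "w \<in> cone z" for w
    using True rv_bounds[of z] rv_bounds[of w]
    by (auto simp: cone_def arrow_le_iff split: if_splits)
  then have "cone z = UNIV" by auto
  then show ?thesis by simp
next
  case False
  have "if \<not> upper z then rv z < 1 else 0 < rv z"
    using False rv_bounds[of z] by (auto split: if_splits)
  then obtain z' where z': "rv z' = rv z" "upper z' \<longleftrightarrow> \<not> upper z"
    using rv_arrow upper_arrow rv_bounds(1,2) by metis
  have "cone z = (if upper z then {z'<..} else {..<z'})"
    by (auto simp: cone_def arrow_less_iff arrow_le_iff z')
  then show ?thesis by auto
qed

lemma open_rv_less: "open {z. rv z < r}"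
proof -
  consider "r \<le> 0" | "r > 1" | "0 < r" "r \<le> 1" by linarith
  then show ?thesis
  proof cases
    case 3
    then have "{z. rv z < r} = {..<arrow False r}"
      by (auto simp: arrow_less_iff rv_arrow upper_arrow)
    then show ?thesis by simp
  next
    case 1
    have "\<not> rv z < r" for z using rv_bounds[of z] 1 by linarith
    then have "{z. rv z < r} = {}" by auto
    then show ?thesis by simp
  next
    case 2
    have "rv z < r" for z using rv_bounds[of z] 2 by linarith
    then have "{z. rv z < r} = UNIV" by auto
    then show ?thesis by simp
  qed
qed

lemma open_rv_greater: "open {z. r < rv z}"
proof -
  consider "r < 0" | "r \<ge> 1" | "0 \<le> r" "r < 1" by linarith
  then show ?thesis
  proof cases
    case 3
    then have "{z. r < rv z} = {arrow True r<..}"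
      by (auto simp: arrow_less_iff rv_arrow upper_arrow)
    then show ?thesis by simp
  next
    case 2
    have "\<not> r < rv z" for z using rv_bounds[of z] 2 by linarith
    then have "{z. r < rv z} = {}" by auto
    then show ?thesis by simp
  next
    case 1
    have "r < rv z" for z using rv_bounds[of z] 1 by linarith
    then have "{z. r < rv z} = UNIV" by auto
    then show ?thesis by simp
  qed
qed

lemma open_nb: "open (nb r z)"
proof -
  have "nb r z = cone z \<inter> (if upper z then {w. rv w < r} else {w. r < rv w})"
    by (auto simp: nb_def)
  then show ?thesis
    using open_cone open_rv_less open_rv_greater by (auto intro!: open_Int)
qed

text \<open>Inside its cone a point differs from all others in real value, which leaves room for a
  rational cutoff. Rationality keeps the cutoffs countable.\<close>

lemma nb_basis:
  assumes "open V" "z \<in> V"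
  obtains r where "r \<in> \<rat>" "z \<in> nb r z" "nb r z \<subseteq> V"
proof (cases "upper z")
  case True
  have "z < arrow False 1"
    using True rv_bounds[of z] by (simp add: arrow_less_iff rv_arrow)
  then obtain b where b: "b > z" "{z..<b} \<subseteq> V"
    using open_right[OF assms] by blast
  have "rv z < rv b" using b(1) True by (auto simp: arrow_less_iff)
  then obtain q where q: "rv z < real_of_rat q" "real_of_rat q < rv b"
    using of_rat_dense by blast
  show ?thesis
    by (rule that[of "of_rat q"]) (use q b True in \<open>auto simp: nb_def cone_def arrow_less_iff\<close>)
next
  case False
  have "arrow True 0 < z"
    using False rv_bounds[of z] by (simp add: arrow_less_iff rv_arrow)
  then obtain b where b: "b < z" "{b<..z} \<subseteq> V"
    using open_left[OF assms] by blast
  have "rv b < rv z" using b(1) False by (auto simp: arrow_less_iff)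
  then obtain q where q: "rv b < real_of_rat q" "real_of_rat q < rv z"
    using of_rat_dense by blast
  show ?thesis
    by (rule that[of "of_rat q"]) (use q b False in \<open>auto simp: nb_def cone_def arrow_less_iff\<close>)
qed

lemma nb_convex:
  assumes "w \<in> nb r z" "w \<le> y \<and> y \<le> z \<or> z \<le> y \<and> y \<le> w"
  shows "y \<in> nb r z"
proof (cases "upper z")
  case True
  then have "z \<le> y" "y \<le> w" using assms by (auto simp: nb_def cone_def)
  moreover have "rv y \<le> rv w" using \<open>y \<le> w\<close> by (auto simp: arrow_le_iff)
  ultimately show ?thesis using True assms(1) by (auto simp: nb_def cone_def)
next
  case False
  then have "y \<le> z" "w \<le> y" using assms by (auto simp: nb_def cone_def)
  moreover have "rv w \<le> rv y" using \<open>w \<le> y\<close> by (auto simp: arrow_le_iff)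
  ultimately show ?thesis using False assms(1) by (auto simp: nb_def cone_def)
qed

text \<open>Bisection of the real interval from 0 to 1: over a short interval around
  \<open>x\<close>, two members of the cover suffice, one for each of the points with value
  \<open>x\<close>.\<close>

lemma compact_double_arrow: "compact (UNIV :: double_arrow set)"
proof (rule compactI)
  fix C :: "double_arrow set set"
  assume C: "\<forall>c\<in>C. open c" "UNIV \<subseteq> \<Union>C"
  define P where "P a b \<longleftrightarrow> (\<exists>D\<subseteq>C. finite D \<and> {z. a \<le> rv z \<and> rv z \<le> b} \<subseteq> \<Union>D)" for a b
  have "P 0 1"
  proof (rule Bolzano)
    show "(0::real) \<le> 1" by simp
  next
    fix a b c assume "P a b" "P b c"
    then obtain D E where D: "D \<subseteq> C" "finite D" "{z. a \<le> rv z \<and> rv z \<le> b} \<subseteq> \<Union>D"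
      and E: "E \<subseteq> C" "finite E" "{z. b \<le> rv z \<and> rv z \<le> c} \<subseteq> \<Union>E"
      unfolding P_def by blast
    have "{z. a \<le> rv z \<and> rv z \<le> c} \<subseteq> \<Union>(D \<union> E)"
    proof
      fix z assume z: "z \<in> {z. a \<le> rv z \<and> rv z \<le> c}"
      then have "z \<in> {z. a \<le> rv z \<and> rv z \<le> b} \<or> z \<in> {z. b \<le> rv z \<and> rv z \<le> c}" by auto
      then show "z \<in> \<Union>(D \<union> E)" using D(3) E(3) by blast
    qed
    then show "P a c" unfolding P_def using D E by (intro exI[of _ "D \<union> E"]) auto
  next
    fix x :: real assume x: "0 \<le> x" "x \<le> 1"
    obtain U where U: "U \<in> C" "arrow True x \<in> U" using C by auto
    obtain V where V: "V \<in> C" "arrow False x \<in> V" using C by auto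
    obtain r where r: "arrow True x \<in> nb r (arrow True x)" "nb r (arrow True x) \<subseteq> U"
      using nb_basis U C by metis
    obtain s where s: "arrow False x \<in> nb s (arrow False x)" "nb s (arrow False x) \<subseteq> V"
      using nb_basis V C by metis
    \<comment> \<open>At \<open>x = 1\<close> there is no upper point and at \<open>x = 0\<close> no
      lower one; the default 1 drops the constraint from that side.\<close>
    define d where "d = min (if x < 1 then r - x else 1) (if x > 0 then x - s else 1)"
    have "d > 0"
      using r(1) s(1) x by (auto simp: d_def nb_def rv_arrow upper_arrow)
    moreover have "P a b" if ab: "a \<le> x \<and> x \<le> b \<and> b - a < d" for a b
    proof -
      have "z \<in> U \<or> z \<in> V" if z: "a \<le> rv z" "rv z \<le> b" for z
      proof (cases "rv z < x \<or> rv z = x \<and> \<not> upper z")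
        case True
        then have "x > 0" using rv_bounds[of z] by auto
        then have "z \<in> nb s (arrow False x)"
          using True ab z x unfolding d_def by (auto simp: nb_def cone_def arrow_le_iff rv_arrow upper_arrow)
        then show ?thesis using s by auto
      next
        case False
        then have "x < 1" using rv_bounds[of z] by (cases "upper z") auto
        then have "z \<in> nb r (arrow True x)"
          using False ab z x unfolding d_def by (auto simp: nb_def cone_def arrow_le_iff rv_arrow upper_arrow)
        then show ?thesis using r by auto
      qed
      then show ?thesis unfolding P_def using U V by (intro exI[of _ "{U, V}"]) auto
    qed
    ultimately show "\<exists>d>0. \<forall>a b. a \<le> x \<and> x \<le> b \<and> b - a < d \<longrightarrow> P a b" by blast
  qed
  moreover have "{z. 0 \<le> rv z \<and> rv z \<le> 1} = UNIV" using rv_bounds by auto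
  ultimately show "\<exists>D\<subseteq>C. finite D \<and> UNIV \<subseteq> \<Union>D" unfolding P_def by simp
qed

section \<open>Locally constant predicates on boxes\<close>

text \<open>By compactness, finitely many products of sets \<open>nb r a\<close> cover the box, with
  \<open>S\<close> constant on each. Whether a point lies in \<open>nb r a\<close> depends only on
  its real value, unless this is the value of \<open>a\<close>; so \<open>Q\<close> collects the
  values of the finitely many centres.\<close>

lemma locally_constant_finitely_determined:
  fixes P :: "nat \<Rightarrow> double_arrow set"
  assumes "\<And>i. i < n \<Longrightarrow> compact (P i)"
    and loc: "\<And>p. p \<in> PiE {..<n} P \<Longrightarrow> \<exists>U. (\<forall>i<n. open (U i) \<and> p i \<in> U i) \<and>
      (\<forall>q\<in>PiE {..<n} P. (\<forall>i<n. q i \<in> U i) \<longrightarrow> (S q \<longleftrightarrow> S p))"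
  shows "\<exists>Q. finite Q \<and> (\<forall>p\<in>PiE {..<n} P. \<forall>q\<in>PiE {..<n} P.
    (\<forall>i<n. rv (p i) = rv (q i) \<and> (rv (p i) \<in> Q \<longrightarrow> p i = q i)) \<longrightarrow> (S p \<longleftrightarrow> S q))"
proof -
  let ?B = "PiE {..<n} P" and ?T = "product_topology (\<lambda>_. euclidean :: double_arrow topology) {..<n}"
  have "\<forall>p\<in>?B. \<exists>r. (\<forall>i<n. p i \<in> nb (r i) (p i)) \<and>
      (\<forall>q\<in>?B. (\<forall>i<n. q i \<in> nb (r i) (p i)) \<longrightarrow> (S q \<longleftrightarrow> S p))"
  proof
    fix p assume p: "p \<in> ?B"
    obtain U where U: "\<forall>i<n. open (U i) \<and> p i \<in> U i"
      "\<forall>q\<in>?B. (\<forall>i<n. q i \<in> U i) \<longrightarrow> (S q \<longleftrightarrow> S p)"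
      using loc[OF p] by blast
    have "\<forall>i. \<exists>r. i < n \<longrightarrow> p i \<in> nb r (p i) \<and> nb r (p i) \<subseteq> U i"
      using U(1) by (meson nb_basis)
    then obtain r where "\<And>i. i < n \<Longrightarrow> p i \<in> nb (r i) (p i) \<and> nb (r i) (p i) \<subseteq> U i" by metis
    then show "\<exists>r. (\<forall>i<n. p i \<in> nb (r i) (p i)) \<and>
      (\<forall>q\<in>?B. (\<forall>i<n. q i \<in> nb (r i) (p i)) \<longrightarrow> (S q \<longleftrightarrow> S p))"
      using U(2) by (intro exI[of _ r]) (auto simp: subset_iff)
  qed
  then have "\<exists>r. \<forall>p\<in>?B. (\<forall>i<n. p i \<in> nb (r p i) (p i)) \<and>
      (\<forall>q\<in>?B. (\<forall>i<n. q i \<in> nb (r p i) (p i)) \<longrightarrow> (S q \<longleftrightarrow> S p))"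
    by (rule bchoice)
  then obtain r where *: "\<forall>p\<in>?B. (\<forall>i<n. p i \<in> nb (r p i) (p i)) \<and>
      (\<forall>q\<in>?B. (\<forall>i<n. q i \<in> nb (r p i) (p i)) \<longrightarrow> (S q \<longleftrightarrow> S p))" ..
  have r: "p i \<in> nb (r p i) (p i)" if "p \<in> ?B" "i < n" for p i
    using *[THEN bspec, OF that(1), THEN conjunct1] that(2) by simp
  have r_const: "S q \<longleftrightarrow> S p" if "p \<in> ?B" "q \<in> ?B" "\<forall>i<n. q i \<in> nb (r p i) (p i)" for p q
    using *[THEN bspec, OF that(1), THEN conjunct2, THEN bspec, OF that(2)] that(3) by (rule mp)
  define K where "K p = PiE {..<n} (\<lambda>i. nb (r p i) (p i))" for p
  have "compactin ?T ?B" unfolding compactin_PiE using assms(1) by simp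
  moreover have "openin ?T U" if "U \<in> K ` ?B" for U
    using that open_nb unfolding K_def by (fastforce simp: openin_PiE_gen)
  moreover have "?B \<subseteq> \<Union>(K ` ?B)"
  proof
    fix p assume p: "p \<in> ?B"
    then have "p \<in> K p" using r[OF p] by (auto simp: K_def PiE_iff)
    then show "p \<in> \<Union>(K ` ?B)" using p by blast
  qed
  ultimately obtain F where F: "finite F" "F \<subseteq> K ` ?B" "?B \<subseteq> \<Union>F"
    using compactinD[of ?T ?B "K ` ?B"] by blast
  obtain A where A: "finite A" "A \<subseteq> ?B" "?B \<subseteq> \<Union>(K ` A)"
    using finite_subset_image[OF F(1,2)] F(3) by metis
  show ?thesis
  proof (intro exI[of _ "\<Union>a\<in>A. (\<lambda>i. rv (a i)) ` {..<n}"] conjI ballI impI)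
    show "finite (\<Union>a\<in>A. (\<lambda>i. rv (a i)) ` {..<n})" using A(1) by simp
  next
    fix p q
    assume p: "p \<in> ?B" and q: "q \<in> ?B" and pq: "\<forall>i<n. rv (p i) = rv (q i) \<and>
      (rv (p i) \<in> (\<Union>a\<in>A. (\<lambda>i. rv (a i)) ` {..<n}) \<longrightarrow> p i = q i)"
    obtain a where a: "a \<in> A" "p \<in> K a" using subsetD[OF A(3) p] by blast
    have "q i \<in> nb (r a i) (a i)" if i: "i < n" for i
    proof (cases "rv (p i) = rv (a i)")
      case True
      then have "rv (p i) \<in> (\<Union>a\<in>A. (\<lambda>i. rv (a i)) ` {..<n})" using a(1) i by blast
      then have "p i = q i" using pq i by blast
      moreover have "p i \<in> nb (r a i) (a i)" using a(2) i unfolding K_def by (metis PiE_E lessThan_iff)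
      ultimately show ?thesis by simp
    next
      case False
      moreover have "p i \<in> nb (r a i) (a i)" using a(2) i unfolding K_def by (metis PiE_E lessThan_iff)
      moreover have "rv (p i) = rv (q i)" using pq i by blast
      ultimately show ?thesis
        by (simp add: nb_def cone_def arrow_le_iff split: if_splits)
    qed
    moreover have "p i \<in> nb (r a i) (a i)" if "i < n" for i
      using a(2) that unfolding K_def by (metis PiE_E lessThan_iff)
    ultimately have "S p \<longleftrightarrow> S a" "S q \<longleftrightarrow> S a"
      using r_const[OF subsetD[OF A(2) a(1)] p] r_const[OF subsetD[OF A(2) a(1)] q] by simp_all
    then show "S p \<longleftrightarrow> S q" by simp
  qed
qed

section \<open>Neighbourhoods in the space of unions of intervals\<close>

lemma interval_unions_subset_Exp:
  "interval_unions m \<subseteq> Exp (euclidean :: 'a::linorder_topology topology)"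
proof
  fix F :: "'a set" assume "F \<in> interval_unions m"
  then obtain \<I> where \<I>: "F = \<Union>\<I>" "finite \<I>" "\<I> \<noteq> {}" "\<forall>I\<in>\<I>. \<exists>a b. a \<le> b \<and> I = {a..b}"
    unfolding interval_unions_def by auto
  have "closed F" unfolding \<I>(1) using \<I>(2,4) by (intro closed_Union) (use closed_atLeastAtMost in metis)+
  moreover have "F \<noteq> {}" using \<I>(1,3,4) by fastforce
  ultimately show "F \<in> Exp euclidean" by (simp add: Exp_def)
qed

lemma interval_unions_nonempty: "G \<in> interval_unions m \<Longrightarrow> G \<noteq> ({} :: 'a::linorder_topology set)"
  using interval_unions_subset_Exp[of m] by (auto simp: Exp_def)

lemma topspace_interval_union_space:
  "topspace (interval_union_space m :: 'a::linorder_topology set topology) = interval_unions m"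
proof -
  have "topspace (vietoris (euclidean :: 'a topology)) = Exp euclidean"
    unfolding vietoris_def topology_generated_by_topspace
    by (auto simp: Exp_def)
  then show ?thesis
    using interval_unions_subset_Exp by (auto simp: interval_union_space_def)
qed

lemma
  fixes V :: "'a::linorder_topology set"
  assumes "open V"
  shows openin_interval_union_space_subset:
      "openin (interval_union_space m) {G \<in> interval_unions m. G \<subseteq> V}" (is ?sub)
    and openin_interval_union_space_meets:
      "openin (interval_union_space m) {G \<in> interval_unions m. G \<inter> V \<noteq> {}}" (is ?meets)
proof -
  show ?sub
  \<comment> \<open>The subbase is indexed by non-empty \<open>V\<close> only, so the empty set is
    treated apart.\<close>
  proof (cases "V = {}")
    case True
    then have "{G \<in> interval_unions m. G \<subseteq> V} = {}" using interval_unions_nonempty by auto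
    then show ?thesis by (simp only: openin_empty)
  next
    case False
    have "openin (vietoris euclidean) {G \<in> Exp euclidean. G \<subseteq> V}"
      unfolding vietoris_def using assms False by (intro topology_generated_by_Basis) auto
    moreover have "{G \<in> interval_unions m. G \<subseteq> V} = {G \<in> Exp euclidean. G \<subseteq> V} \<inter> interval_unions m"
      using interval_unions_subset_Exp by auto
    ultimately show ?thesis
      unfolding interval_union_space_def openin_subtopology by blast
  qed
  show ?meets
  proof (cases "V = {}")
    case False
    have "openin (vietoris euclidean) {G \<in> Exp euclidean. G \<inter> V \<noteq> {}}"
      unfolding vietoris_def using assms False by (intro topology_generated_by_Basis) auto
    moreover have "{G \<in> interval_unions m. G \<inter> V \<noteq> {}} = {G \<in> Exp euclidean. G \<inter> V \<noteq> {}} \<inter> interval_unions m"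
      using interval_unions_subset_Exp by auto
    ultimately show ?thesis
      unfolding interval_union_space_def openin_subtopology by blast
  qed auto
qed

text \<open>Reduces a neighbourhood property to subbasic sets; a union is handled by enlarging one
  member. Since \<open>mono\<close> compares only inside \<open>interval_unions m\<close>, the
  subbasic sets can be written without \<open>Exp\<close>.\<close>

lemma interval_union_space_nhds_induct [consumes 2, case_names subset meets Int mono]:
  fixes W :: "'a::linorder_topology set set"
  assumes "openin (interval_union_space m) W" "F \<in> W"
    and subset: "\<And>V. open V \<Longrightarrow> F \<subseteq> V \<Longrightarrow> P {G. G \<subseteq> V}"
    and meets: "\<And>V. open V \<Longrightarrow> F \<inter> V \<noteq> {} \<Longrightarrow> P {G. G \<inter> V \<noteq> {}}"
    and Int: "\<And>S T. P S \<Longrightarrow> P T \<Longrightarrow> P (S \<inter> T)"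
    and mono: "\<And>S T. P S \<Longrightarrow> S \<inter> interval_unions m \<subseteq> T \<Longrightarrow> P T"
  shows "P W"
proof -
  obtain T where T: "openin (vietoris euclidean) T" "W = T \<inter> interval_unions m"
    using assms(1) unfolding interval_union_space_def openin_subtopology by blast
  have "F \<in> T" using T assms(2) by auto
  with T(1)[unfolded vietoris_def openin_topology_generated_by_iff] have "P T"
  proof induct
    case Empty
    then show ?case by simp
  next
    case (Int a b)
    then show ?case using assms(5) by auto
  next
    case (UN K)
    then obtain k where "k \<in> K" "P k" by auto
    then show ?case by (elim mono) auto
  next
    case (Basis s)
    then consider V where "open V" "s = {F \<in> Exp euclidean. F \<subseteq> V}"
      | V where "open V" "s = {F \<in> Exp euclidean. F \<inter> V \<noteq> {}}" by auto
    then show ?case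
    proof cases
      case 1
      then have "P {G. G \<subseteq> V}" using Basis subset by auto
      then show ?thesis using 1 interval_unions_subset_Exp[of m] by (elim mono) auto
    next
      case 2
      then have "P {G. G \<inter> V \<noteq> {}}" using Basis meets by auto
      then show ?thesis using 2 interval_unions_subset_Exp[of m] by (elim mono) auto
    qed
  qed
  then show ?thesis using T by (elim mono) auto
qed

text \<open>A non-empty \<open>G \<subseteq> V\<close> also meets \<open>V\<close>, so at a
  singleton the conditions of meeting an open set follow from conditions of containment.\<close>

lemma nhds_singleton_interval_union_space:
  fixes W :: "'a::linorder_topology set set"
  assumes "openin (interval_union_space m) W" "{c} \<in> W"
  obtains V where "open V" "c \<in> V" "\<forall>G\<in>interval_unions m. G \<subseteq> V \<longrightarrow> G \<in> W"
proof -
  from assms have "\<exists>V. open V \<and> c \<in> V \<and> (\<forall>G\<in>interval_unions m. G \<subseteq> V \<longrightarrow> G \<in> W)"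
  proof (induct rule: interval_union_space_nhds_induct)
    case (subset V)
    then show ?case by auto
  next
    case (meets V)
    then show ?case using interval_unions_nonempty by (intro exI[of _ V]) auto
  next
    case (Int S T)
    then obtain U V where "open U" "c \<in> U" "\<forall>G\<in>interval_unions m. G \<subseteq> U \<longrightarrow> G \<in> S"
      "open V" "c \<in> V" "\<forall>G\<in>interval_unions m. G \<subseteq> V \<longrightarrow> G \<in> T" by blast
    then show ?case by (intro exI[of _ "U \<inter> V"]) auto
  next
    case (mono S T)
    then show ?case by blast
  qed
  then show ?thesis using that by blast
qed

section \<open>Unions of exactly \<open>m\<close> intervals with endpoints in prescribed cells\<close>

text \<open>An increasing sequence in \<open>[0, 1)\<close> that serves all \<open>m\<close> at once; consecutive cells below are
  separated by gaps.\<close>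

definition grid :: "nat \<Rightarrow> real" where
  "grid k = 1 - 1 / (real k + 1)"

lemma grid_less_iff [simp]: "grid j < grid k \<longleftrightarrow> j < k"
  by (simp add: grid_def field_simps)

lemma grid_eq_iff [simp]: "grid j = grid k \<longleftrightarrow> j = k"
  by (metis grid_less_iff nat_neq_iff order_less_irrefl)

lemma grid_bounds: "0 \<le> grid k" "grid k < 1" "0 < k \<Longrightarrow> 0 < grid k"
  by (simp_all add: grid_def field_simps)

text \<open>Left ends are upper points and right ends are lower points, so that the interval between
  them is an intersection of two cones and the cells are clopen.\<close>

definition left_end :: "nat \<Rightarrow> double_arrow" where
  "left_end j = arrow True (grid (2 * j))"

definition right_end :: "nat \<Rightarrow> double_arrow" where
  "right_end j = arrow False (grid (2 * j + 1))"

lemma ends [simp]: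
  "rv (left_end j) = grid (2 * j)" "upper (left_end j)"
  "rv (right_end j) = grid (2 * j + 1)" "\<not> upper (right_end j)"
  using grid_bounds[of "2 * j"] grid_bounds[of "2 * j + 1"]
  by (simp_all add: left_end_def right_end_def rv_arrow upper_arrow)

lemma left_end_le_right_end_iff: "left_end j \<le> right_end k \<longleftrightarrow> j \<le> k"
  by (auto simp: arrow_le_iff)

lemma right_end_less_left_end: "j < k \<Longrightarrow> right_end j < left_end k"
  by (auto simp: arrow_less_iff)

definition cell :: "nat \<Rightarrow> double_arrow set" where
  "cell j = {left_end j..right_end j}"

lemma mem_cell_iff:
  "z \<in> cell j \<longleftrightarrow> left_end j \<le> z \<and> z \<le> right_end j"
  by (simp add: cell_def)

lemma open_cell: "open (cell j)"
proof -
  have "cell j = cone (left_end j) \<inter> cone (right_end j)"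
    by (auto simp: cell_def cone_def)
  then show ?thesis by (simp add: open_cone open_Int)
qed

lemma closed_cell: "closed (cell j)"
  by (simp add: cell_def)

lemma compact_cell: "compact (cell j)"
  using compact_Int_closed[OF compact_double_arrow closed_cell] by simp

text \<open>The vectors are extensional, so that they are determined by their \<open>2 * m\<close>
  coordinates, as \<open>inj_on_segments\<close> requires.\<close>

definition box :: "nat \<Rightarrow> (nat \<Rightarrow> double_arrow) set" where
  "box m = PiE {..<2 * m} cell"

definition segments :: "nat \<Rightarrow> (nat \<Rightarrow> double_arrow) \<Rightarrow> double_arrow set" where
  "segments m p = (\<Union>i<m. {p (2 * i)..p (2 * i + 1)})"

lemma box_cell: "p \<in> box m \<Longrightarrow> j < 2 * m \<Longrightarrow> p j \<in> cell j"
  by (auto simp: box_def)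

lemma box_less:
  assumes "p \<in> box m" "i < m"
  shows "p (2 * i) < p (2 * i + 1)"
proof -
  have "p (2 * i) \<le> right_end (2 * i)" "left_end (2 * i + 1) \<le> p (2 * i + 1)"
    using assms box_cell[of p m "2 * i"] box_cell[of p m "2 * i + 1"] by (auto simp: mem_cell_iff)
  then show ?thesis
    using right_end_less_left_end[OF less_add_one, of "2 * i"] by order
qed

lemma segments_in_interval_unions:
  assumes "p \<in> box m" "m \<ge> 1"
  shows "segments m p \<in> interval_unions m"
  unfolding interval_unions_def
proof (intro CollectI exI conjI)
  let ?I = "(\<lambda>i. {p (2 * i)..p (2 * i + 1)}) ` {..<m}"
  show "segments m p = \<Union>?I" by (simp add: segments_def)
  show "finite ?I" by simp
  show "?I \<noteq> {}" using assms(2) by (auto simp: lessThan_empty_iff)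
  show "card ?I \<le> m" using card_image_le[of "{..<m}"] by (metis card_lessThan finite_lessThan)
  show "\<forall>I\<in>?I. \<exists>a b. a \<le> b \<and> I = {a..b}"
    using box_less[OF assms(1)] by (auto intro: less_imp_le)
qed

text \<open>Each cell holds just one endpoint, a left one for even \<open>j\<close> and a right one
  for odd \<open>j\<close>. The trace on the cell thus depends on coordinate \<open>j\<close> alone,
  which lets the coordinates be read off from the union.\<close>

lemma segments_Int_cell:
  assumes "p \<in> box m" "j < 2 * m"
  shows "segments m p \<inter> cell j = cell j \<inter> (if even j then {p j..} else {..p j})"
proof -
  \<comment> \<open>Interval number \<open>k\<close> runs from cell \<open>2 * k\<close> to cell
    \<open>2 * k + 1\<close>, so it reaches no other cells.\<close>
  have k: "j div 2 = k" if "k < m" "z \<in> cell j" "p (2 * k) \<le> z" "z \<le> p (2 * k + 1)" for k z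
  proof -
    have "left_end (2 * k) \<le> p (2 * k)" "p (2 * k + 1) \<le> right_end (2 * k + 1)"
      using assms that(1) box_cell[of p m "2 * k"] box_cell[of p m "2 * k + 1"]
      by (auto simp: mem_cell_iff)
    then have "left_end (2 * k) \<le> right_end j" "left_end j \<le> right_end (2 * k + 1)"
      using that by (auto simp: mem_cell_iff)
    then show ?thesis unfolding left_end_le_right_end_iff by auto
  qed
  let ?k = "j div 2"
  have "?k < m" using assms by auto
  have "segments m p \<inter> cell j = {p (2 * ?k)..p (2 * ?k + 1)} \<inter> cell j"
  proof (intro equalityI subsetI)
    fix z assume z: "z \<in> segments m p \<inter> cell j"
    then obtain l where "l < m" "p (2 * l) \<le> z" "z \<le> p (2 * l + 1)" by (auto simp: segments_def)
    then show "z \<in> {p (2 * ?k)..p (2 * ?k + 1)} \<inter> cell j" using k[of l z] z by simp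
  next
    fix z assume "z \<in> {p (2 * ?k)..p (2 * ?k + 1)} \<inter> cell j"
    then show "z \<in> segments m p \<inter> cell j" using \<open>?k < m\<close> unfolding segments_def by blast
  qed
  also have "\<dots> = cell j \<inter> (if even j then {p j..} else {..p j})"
  proof (cases "even j")
    case True
    then have j: "2 * ?k = j" by simp
    have "z \<le> p (j + 1)" if "z \<in> cell j" for z
    proof -
      have "left_end (j + 1) \<le> p (j + 1)"
        using assms True box_cell[of p m "j + 1"] j \<open>?k < m\<close> by (auto simp: mem_cell_iff)
      then show ?thesis
        using that right_end_less_left_end[of j "j + 1"] by (auto simp: mem_cell_iff)
    qed
    then show ?thesis using True j by auto
  next
    case False
    then have j: "2 * ?k + 1 = j" by simp
    have "p (2 * ?k) \<le> z" if "z \<in> cell j" for z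
    proof -
      have "p (2 * ?k) \<le> right_end (2 * ?k)"
        using assms box_cell[of p m "2 * ?k"] \<open>?k < m\<close> by (auto simp: mem_cell_iff)
      moreover have "right_end (2 * ?k) < left_end j"
        using j by (intro right_end_less_left_end) simp
      ultimately show ?thesis
        using that by (auto simp: mem_cell_iff)
    qed
    then show ?thesis using False j by auto
  qed
  finally show ?thesis .
qed

lemma inj_on_segments: "inj_on (segments m) (box m)"
proof (rule inj_onI)
  fix p q assume p: "p \<in> box m" and q: "q \<in> box m" and eq: "segments m p = segments m q"
  show "p = q"
  proof (rule PiE_ext)
    show "p \<in> PiE {..<2 * m} cell" "q \<in> PiE {..<2 * m} cell" using p q by (simp_all add: box_def)
    fix j assume "j \<in> {..<2 * m}"
    then have j: "j < 2 * m" by simp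
    have "cell j \<inter> (if even j then {p j..} else {..p j}) = cell j \<inter> (if even j then {q j..} else {..q j})"
      using segments_Int_cell[OF p j] segments_Int_cell[OF q j] eq by simp
    then show "p j = q j"
      using box_cell[OF p j] box_cell[OF q j] by (auto split: if_splits intro: antisym)
  qed
qed

text \<open>Continuity of \<open>segments m\<close>, spelled out with a neighbourhood for each
  coordinate so as to fit \<open>locally_constant_finitely_determined\<close>.\<close>

lemma segments_continuous:
  assumes "openin (interval_union_space m) W" "segments m p \<in> W" "p \<in> box m" "m \<ge> 1"
  shows "\<exists>U. (\<forall>i<2 * m. open (U i) \<and> p i \<in> U i) \<and>
    (\<forall>q\<in>box m. (\<forall>i<2 * m. q i \<in> U i) \<longrightarrow> segments m q \<in> W)"
  using assms(1,2)
proof (induct rule: interval_union_space_nhds_induct)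
  case (subset V)
  have end_in: "p i \<in> V" if "i < 2 * m" for i
  proof -
    have "p i \<in> segments m p \<inter> cell i"
      unfolding segments_Int_cell[OF assms(3) that] using box_cell[OF assms(3) that] by simp
    then show ?thesis using subset by auto
  qed
  then have "\<forall>i. \<exists>r. i < 2 * m \<longrightarrow> p i \<in> nb r (p i) \<and> nb r (p i) \<subseteq> V"
    using subset(1) by (meson nb_basis)
  then obtain r where r: "\<And>i. i < 2 * m \<Longrightarrow> p i \<in> nb (r i) (p i) \<and> nb (r i) (p i) \<subseteq> V" by metis
  \<comment> \<open>A point of the new union lies in the old one or between an old endpoint and the
    new one, where convexity of \<open>nb\<close> keeps it in \<open>V\<close>.\<close>
  have "segments m q \<subseteq> V" if q: "\<forall>i<2 * m. q i \<in> nb (r i) (p i)" for q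
  proof
    fix z assume "z \<in> segments m q"
    then obtain k where k: "k < m" "q (2 * k) \<le> z" "z \<le> q (2 * k + 1)" by (auto simp: segments_def)
    consider "z \<le> p (2 * k)" | "p (2 * k + 1) \<le> z" | "p (2 * k) \<le> z" "z \<le> p (2 * k + 1)"
      by (metis linear)
    then show "z \<in> V"
    proof cases
      case 1
      then have "z \<in> nb (r (2 * k)) (p (2 * k))"
        using nb_convex[of "q (2 * k)" "r (2 * k)" "p (2 * k)" z] q k by auto
      then show ?thesis using r[of "2 * k"] k by auto
    next
      case 2
      then have "z \<in> nb (r (2 * k + 1)) (p (2 * k + 1))"
        using nb_convex[of "q (2 * k + 1)" "r (2 * k + 1)" "p (2 * k + 1)" z] q k by auto
      then show ?thesis using r[of "2 * k + 1"] k by auto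
    next
      case 3
      then have "z \<in> segments m p" using k by (auto simp: segments_def)
      then show ?thesis using subset by auto
    qed
  qed
  then show ?case using r open_nb by (intro exI[of _ "\<lambda>i. nb (r i) (p i)"]) auto
next
  case (meets V)
  then obtain z k where z: "z \<in> V" "k < m" "p (2 * k) \<le> z" "z \<le> p (2 * k + 1)"
    by (auto simp: segments_def)
  have q: "q (2 * k) \<le> q (2 * k + 1)" "{q (2 * k)..q (2 * k + 1)} \<subseteq> segments m q" if "q \<in> box m" for q
    using box_less[OF that \<open>k < m\<close>] \<open>k < m\<close> by (auto simp: segments_def)
  \<comment> \<open>If the witness \<open>z\<close> is an endpoint, it suffices to keep that
    endpoint in \<open>V\<close>; otherwise both endpoints are kept on their sides of
    \<open>z\<close>.\<close>
  consider i where "i \<in> {2 * k, 2 * k + 1}" "z = p i" | "p (2 * k) < z" "z < p (2 * k + 1)"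
    using z by fastforce
  then show ?case
  proof cases
    case 1
    then have "i < 2 * m" using \<open>k < m\<close> by auto
    have "segments m q \<inter> V \<noteq> {}" if "q \<in> box m" "q i \<in> V" for q
      using q[OF that(1)] 1 that(2) by auto
    then show ?thesis
      using 1 z \<open>open V\<close> \<open>i < 2 * m\<close>
      by (intro exI[of _ "\<lambda>j. if j = i then V else UNIV"]) simp
  next
    case 2
    have "segments m q \<inter> V \<noteq> {}" if "q \<in> box m" "q (2 * k) < z" "z < q (2 * k + 1)" for q
    proof -
      have "z \<in> {q (2 * k)..q (2 * k + 1)}" using that by (simp add: less_imp_le)
      then show ?thesis using q(2)[OF that(1)] z(1) by blast
    qed
    moreover define U where "U = (\<lambda>j. if j = 2 * k then {..<z} else if j = 2 * k + 1 then {z<..} else UNIV)"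
    moreover from this have "U (2 * k) = {..<z}" "U (2 * k + 1) = {z<..}" by simp_all
    ultimately have "segments m q \<inter> V \<noteq> {}" if "q \<in> box m" "\<forall>i<2 * m. q i \<in> U i" for q
      using that(1) that(2)[rule_format, of "2 * k"] that(2)[rule_format, of "2 * k + 1"] \<open>k < m\<close> by simp
    moreover have "\<forall>i<2 * m. open (U i) \<and> p i \<in> U i" using 2 by (simp add: U_def)
    ultimately show ?thesis by blast
  qed
next
  case (Int S T)
  then obtain U U' where "\<forall>i<2 * m. open (U i) \<and> p i \<in> U i"
    "\<forall>q\<in>box m. (\<forall>i<2 * m. q i \<in> U i) \<longrightarrow> segments m q \<in> S"
    "\<forall>i<2 * m. open (U' i) \<and> p i \<in> U' i"
    "\<forall>q\<in>box m. (\<forall>i<2 * m. q i \<in> U' i) \<longrightarrow> segments m q \<in> T" by blast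
  then show ?case by (intro exI[of _ "\<lambda>i. U i \<inter> U' i"]) auto
next
  case (mono S T)
  then show ?case using segments_in_interval_unions assms(4) by blast
qed

section \<open>An open set made up of such unions\<close>

definition cluster :: "nat \<Rightarrow> double_arrow set" where
  "cluster i = {left_end (2 * i)..right_end (2 * i + 1)}"

lemma cluster_Int_cell:
  assumes "z \<in> cluster k" "z \<in> cell j"
  shows "k = j div 2"
proof -
  have "left_end (2 * k) \<le> right_end j" "left_end j \<le> right_end (2 * k + 1)"
    using assms by (auto simp: cluster_def mem_cell_iff)
  then show ?thesis unfolding left_end_le_right_end_iff by auto
qed

lemma interval_within_cluster:
  assumes "{a..b} \<subseteq> (\<Union>i<m. cluster i)" "a \<le> b"
  shows "\<exists>k<m. {a..b} \<subseteq> cluster k"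
proof -
  have "a \<in> (\<Union>i<m. cluster i)" using assms by auto
  then obtain k where k: "k < m" "a \<in> cluster k" by auto
  have "b \<le> right_end (2 * k + 1)"
  proof (rule ccontr)
    assume "\<not> b \<le> right_end (2 * k + 1)"
    \<comment> \<open>\<open>g\<close> is the partner of the last point of cluster \<open>k\<close>
      across the gap; it lies in no cluster.\<close>
    define g where "g = arrow True (grid (2 * (2 * k + 1) + 1))"
    have g: "rv g = grid (2 * (2 * k + 1) + 1)" "upper g"
      using grid_bounds[of "2 * (2 * k + 1) + 1"] by (auto simp: g_def rv_arrow upper_arrow)
    have "a \<le> right_end (2 * k + 1)" using k by (simp add: cluster_def)
    then have "a \<le> g" by (auto simp: arrow_le_iff g)
    moreover have "g \<le> b" using \<open>\<not> b \<le> right_end (2 * k + 1)\<close> by (auto simp: arrow_le_iff g)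
    ultimately have "g \<in> (\<Union>i<m. cluster i)" using assms by auto
    then obtain l where "g \<in> cluster l" by auto
    then show False by (auto simp: cluster_def arrow_le_iff g) presburger
  qed
  then have "{a..b} \<subseteq> cluster k" using k by (auto simp: cluster_def)
  then show ?thesis using k by blast
qed

text \<open>Finitely many subbasic conditions, hence an open set; for \<open>m \<ge> 1\<close> it
  turns out to be exactly the image of the box under \<open>segments m\<close>.\<close>

definition segments_nhd :: "nat \<Rightarrow> double_arrow set set" where
  "segments_nhd m = {G \<in> interval_unions m. G \<subseteq> (\<Union>i<m. cluster i) \<and> (\<forall>j<2 * m. G \<inter> cell j \<noteq> {})}"

lemma openin_segments_nhd: "openin (interval_union_space m) (segments_nhd m)"
proof -
  have "cluster i = cone (left_end (2 * i)) \<inter> cone (right_end (2 * i + 1))" for i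
    by (auto simp: cluster_def cone_def)
  then have "open (\<Union>i<m. cluster i)" by (auto simp: open_cone intro!: open_Int)
  then have "openin (interval_union_space m) ({G \<in> interval_unions m. G \<subseteq> (\<Union>i<m. cluster i)} \<inter>
    ((\<Inter>j<2 * m. {G \<in> interval_unions m. G \<inter> cell j \<noteq> {}}) \<inter> topspace (interval_union_space m)))"
    by (intro openin_Int openin_interval_union_space_subset openin_INT openin_interval_union_space_meets open_cell)
      auto
  moreover have "segments_nhd m = {G \<in> interval_unions m. G \<subseteq> (\<Union>i<m. cluster i)} \<inter>
    ((\<Inter>j<2 * m. {G \<in> interval_unions m. G \<inter> cell j \<noteq> {}}) \<inter> topspace (interval_union_space m))"
    by (auto simp: segments_nhd_def topspace_interval_union_space)
  ultimately show ?thesis by simp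
qed

lemma segments_in_segments_nhd:
  assumes "p \<in> box m" "m \<ge> 1"
  shows "segments m p \<in> segments_nhd m"
proof -
  have "{p (2 * i)..p (2 * i + 1)} \<subseteq> cluster i" if "i < m" for i
    using box_cell[OF assms(1), of "2 * i"] box_cell[OF assms(1), of "2 * i + 1"] that
    by (auto simp: cluster_def mem_cell_iff)
  then have "segments m p \<subseteq> (\<Union>i<m. cluster i)" by (auto simp: segments_def subset_iff)
  moreover have "segments m p \<inter> cell j \<noteq> {}" if "j < 2 * m" for j
    unfolding segments_Int_cell[OF assms(1) that] using box_cell[OF assms(1) that] by auto
  ultimately show ?thesis
    using segments_in_interval_unions[OF assms] by (simp add: segments_nhd_def)
qed

text \<open>A member of \<open>segments_nhd m\<close> needs an interval in each of the \<open>m\<close> clusters, hence has exactly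
  one there.\<close>

lemma segments_nhd_subset: "segments_nhd m \<subseteq> segments m ` box m"
proof
  fix G assume "G \<in> segments_nhd m"
  then have sub: "G \<subseteq> (\<Union>i<m. cluster i)" and meet: "\<And>j. j < 2 * m \<Longrightarrow> G \<inter> cell j \<noteq> {}"
    and "G \<in> interval_unions m" by (auto simp: segments_nhd_def)
  then obtain \<I> where \<I>: "G = \<Union>\<I>" "finite \<I>" "card \<I> \<le> m" "\<forall>I\<in>\<I>. \<exists>a b. a \<le> b \<and> I = {a..b}"
    unfolding interval_unions_def by auto
  have cl: "\<exists>k<m. I \<subseteq> cluster k" if I: "I \<in> \<I>" for I
  proof -
    obtain a b where "a \<le> b" "I = {a..b}" using \<I>(4) I by blast
    then show ?thesis using interval_within_cluster[of a b m] sub \<I>(1) I by blast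
  qed
  have cell_cl: "I \<subseteq> cluster (j div 2)" if I: "I \<in> \<I>" "z \<in> I" "z \<in> cell j" for I z j
  proof -
    obtain k where k: "I \<subseteq> cluster k" using cl[OF I(1)] by blast
    then have "k = j div 2" using cluster_Int_cell[OF _ I(3)] I(2) by blast
    then show ?thesis using k by simp
  qed
  have "\<exists>I. I \<in> \<I> \<and> I \<inter> cell (2 * i) \<noteq> {}" if "i < m" for i
  proof -
    have "G \<inter> cell (2 * i) \<noteq> {}" using that by (intro meet) simp
    then show ?thesis using \<I>(1) by blast
  qed
  then have "\<exists>J. \<forall>i\<in>{..<m}. J i \<in> \<I> \<and> J i \<inter> cell (2 * i) \<noteq> {}"
    by (intro bchoice) simp
  then obtain J where J: "\<And>i. i < m \<Longrightarrow> J i \<in> \<I> \<and> J i \<inter> cell (2 * i) \<noteq> {}" by blast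
  have Jcl: "J i \<subseteq> cluster i" if "i < m" for i
    using cell_cl[of "J i" _ "2 * i"] J[OF that] by auto
  have "inj_on J {..<m}"
  proof (rule inj_onI)
    fix i j assume "i \<in> {..<m}" "j \<in> {..<m}" "J i = J j"
    then show "i = j"
      using J[of i] Jcl[of j] cluster_Int_cell[of _ j "2 * i"] by auto
  qed
  then have J_onto: "J ` {..<m} = \<I>"
    using \<I>(2,3) J by (intro card_seteq) (auto simp: card_image)
  have "\<forall>i\<in>{..<m}. \<exists>a b. a \<le> b \<and> J i = {a..b}"
  proof
    fix i assume "i \<in> {..<m}"
    then have "J i \<in> \<I>" using J by simp
    with \<I>(4) show "\<exists>a b. a \<le> b \<and> J i = {a..b}" by (rule bspec)
  qed
  from bchoice[OF this] obtain a where "\<forall>i\<in>{..<m}. \<exists>b. a i \<le> b \<and> J i = {a i..b}" ..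
  from bchoice[OF this] obtain b where ab: "\<And>i. i < m \<Longrightarrow> a i \<le> b i \<and> J i = {a i..b i}" by blast
  define p where "p = (\<lambda>j\<in>{..<2 * m}. if even j then a (j div 2) else b (j div 2))"
  have p: "p (2 * i) = a i" "p (2 * i + 1) = b i" if "i < m" for i
    using that by (auto simp: p_def)
  \<comment> \<open>\<open>J i\<close> has a point in cell \<open>2 * i\<close> and stays in cluster
    \<open>i\<close>, which starts where this cell starts.\<close>
  have a_cell: "a i \<in> cell (2 * i)" if i: "i < m" for i
  proof -
    obtain z where "z \<in> J i" "z \<in> cell (2 * i)" using J[OF i] by auto
    moreover have "a i \<in> cluster i" using Jcl[OF i] ab[OF i] by auto
    ultimately show ?thesis using ab[OF i] by (auto simp: mem_cell_iff cluster_def)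
  qed
  \<comment> \<open>A point of \<open>G\<close> in cell \<open>2 * i + 1\<close> can only come from
    \<open>J i\<close>, since the other \<open>J k\<close> lie in other clusters; so the right end
    of \<open>J i\<close> reaches this cell.\<close>
  have b_cell: "b i \<in> cell (2 * i + 1)" if i: "i < m" for i
  proof -
    obtain z where z: "z \<in> G" "z \<in> cell (2 * i + 1)" using meet[of "2 * i + 1"] i by auto
    then obtain k where k: "k < m" "z \<in> J k" using \<I>(1) J_onto by auto
    then have "k = i" using Jcl[OF k(1)] cluster_Int_cell[of z k "2 * i + 1"] z by auto
    moreover have "b i \<in> cluster i" using Jcl[OF i] ab[OF i] by auto
    ultimately show ?thesis using ab[OF i] z k by (auto simp: mem_cell_iff cluster_def)
  qed
  have "p j \<in> cell j" if "j < 2 * m" for j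
  proof (cases "even j")
    case True
    then obtain i where "j = 2 * i" ..
    then show ?thesis using a_cell[of i] p(1)[of i] that by simp
  next
    case False
    then obtain i where "j = 2 * i + 1" ..
    then show ?thesis using b_cell[of i] p(2)[of i] that by simp
  qed
  then have "p \<in> box m" by (auto simp: box_def p_def)
  moreover have "G = segments m p"
  proof -
    have "G = (\<Union>i<m. J i)" using \<I>(1) J_onto by simp
    also have "\<dots> = segments m p" unfolding segments_def using ab p by (intro SUP_cong) simp_all
    finally show ?thesis .
  qed
  ultimately show "G \<in> segments m ` box m" by blast
qed

text \<open>A cone that points into the interval contains the endpoint iff it contains the whole
  trace on the cell; a cone that points away from it contains the endpoint iff it meets the trace.
  Both are open conditions on the union.\<close>

lemma openin_segments_cones:
  assumes "m \<ge> 1"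
  obtains M where "openin (interval_union_space m) M"
    "\<forall>q\<in>box m. segments m q \<in> M \<longleftrightarrow> (\<forall>j<2 * m. q j \<in> cone (c j))"
proof -
  \<comment> \<open>\<open>upper (c j) = even j\<close> says that the cone points into the interval:
    rightwards at a left end, leftwards at a right end.\<close>
  define M where "M j = (if upper (c j) = even j
    then {G \<in> interval_unions m. G \<subseteq> - cell j \<union> cone (c j)}
    else {G \<in> interval_unions m. G \<inter> (cell j \<inter> cone (c j)) \<noteq> {}})" for j
  have "openin (interval_union_space m) (M j)" for j
    unfolding M_def
    using openin_interval_union_space_subset[of "- cell j \<union> cone (c j)" m]
      openin_interval_union_space_meets[of "cell j \<inter> cone (c j)" m]
      open_cell[of j] open_cone[of "c j"] closed_cell[of j]
    by (auto simp: open_Int open_Un open_Compl)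
  then have "openin (interval_union_space m) ((\<Inter>j<2 * m. M j) \<inter> topspace (interval_union_space m))"
    by (intro openin_INT) auto
  moreover have "segments m q \<in> M j \<longleftrightarrow> q j \<in> cone (c j)" if q: "q \<in> box m" "j < 2 * m" for q j
  proof -
    have "segments m q \<in> M j \<longleftrightarrow> (if upper (c j) = even j then segments m q \<inter> cell j \<subseteq> cone (c j)
        else (segments m q \<inter> cell j) \<inter> cone (c j) \<noteq> {})"
      using segments_in_interval_unions[OF q(1) assms] by (auto simp: M_def)
    also have "\<dots> \<longleftrightarrow> q j \<in> cone (c j)"
      unfolding segments_Int_cell[OF q] using box_cell[OF q]
      by (auto simp: cone_def subset_iff)
    finally show ?thesis .
  qed
  ultimately show ?thesis
    using segments_in_interval_unions[OF _ assms]
    by (intro that[of "(\<Inter>j<2 * m. M j) \<inter> topspace (interval_union_space m)"])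
      (auto simp: topspace_interval_union_space)
qed

section \<open>Moving the endpoints across gaps\<close>

text \<open>\<open>Q\<close> is the set of values at which points stay put. Below it always contains
  0 and 1, where a partner is missing.\<close>

definition flip :: "real set \<Rightarrow> double_arrow \<Rightarrow> double_arrow" where
  "flip Q z = (if rv z \<in> Q then z else arrow (\<not> upper z) (rv z))"

lemma
  assumes "{0, 1} \<subseteq> Q"
  shows rv_flip: "rv (flip Q z) = rv z" and upper_flip: "upper (flip Q z) \<longleftrightarrow> (upper z \<longleftrightarrow> rv z \<in> Q)"
proof -
  have "rv z \<notin> Q \<Longrightarrow> rv z \<noteq> 0 \<and> rv z \<noteq> 1" using assms by auto
  then show "rv (flip Q z) = rv z" "upper (flip Q z) \<longleftrightarrow> (upper z \<longleftrightarrow> rv z \<in> Q)"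
    using rv_bounds(1,2)[of z] by (auto simp: flip_def rv_arrow upper_arrow)
qed

text \<open>Only an end of the cell could leave it by a flip, and the values of the ends belong to
  \<open>Q\<close>.\<close>

lemma flip_cell:
  assumes "{0, 1} \<subseteq> Q" "range grid \<subseteq> Q" "z \<in> cell j"
  shows "flip Q z \<in> cell j"
proof (cases "rv z \<in> Q")
  case True
  then show ?thesis using assms by (simp add: flip_def)
next
  case False
  then have "rv z \<noteq> grid k" "grid k \<noteq> rv z" for k using False assms(2) by (metis rangeI subset_iff)+
  then show ?thesis
    using assms(3) by (auto simp: mem_cell_iff arrow_le_iff rv_flip[OF assms(1)])
qed

text \<open>The cone of a flipped point looks away from that of the point itself.\<close>

lemma flip_cone_imp_nb:
  assumes "{0, 1} \<subseteq> Q" "upper z = upper z'" "z \<in> nb r z" "rv z \<in> Q \<or> rv z' \<in> Q \<Longrightarrow> z = z'"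
    and "flip Q z' \<in> cone (flip Q z)"
  shows "z \<in> nb r z'"
proof (cases "rv z \<in> Q \<or> rv z' \<in> Q")
  case True
  then show ?thesis using assms by auto
next
  case False
  then show ?thesis
    using assms(2,3,5)
    by (auto simp: cone_def nb_def arrow_le_iff rv_flip[OF assms(1)] upper_flip[OF assms(1)] split: if_splits)
qed

section \<open>The singleton of the least point is not like a union of exactly \<open>m\<close> intervals\<close>

lemma interval_in_interval_unions:
  assumes "a \<le> b" "m \<ge> 1"
  shows "{a..b} \<in> interval_unions m"
  unfolding interval_unions_def using assms by (intro CollectI exI[of _ "{{a..b}}"]) auto

text \<open>As \<open>E\<close> is clopen, both being contained in \<open>E\<close> and meeting
  \<open>- E\<close> are open conditions. So the predicate is locally constant on the compact
  box.\<close>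

lemma clopen_finitely_determined:
  fixes E :: "double_arrow set"
  assumes g: "continuous_map (interval_union_space m) (interval_union_space m) g"
    and m: "m \<ge> 1" and E: "open E" "open (- E)"
  shows "\<exists>Q. finite Q \<and> (\<forall>p\<in>box m. \<forall>q\<in>box m.
      (\<forall>i<2 * m. rv (p i) = rv (q i) \<and> (rv (p i) \<in> Q \<longrightarrow> p i = q i)) \<longrightarrow>
      (g (segments m p) \<subseteq> E \<longleftrightarrow> g (segments m q) \<subseteq> E))"
proof -
  let ?X = "interval_union_space m :: double_arrow set topology"
  have g_in: "g G \<in> interval_unions m" if "G \<in> interval_unions m" for G
    using continuous_map_image_subset_topspace[OF g] that by (auto simp: topspace_interval_union_space)
  define S where "S p \<longleftrightarrow> g (segments m p) \<subseteq> E" for p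
  have loc: "\<exists>U. (\<forall>i<2 * m. open (U i) \<and> p i \<in> U i) \<and>
      (\<forall>q\<in>PiE {..<2 * m} cell. (\<forall>i<2 * m. q i \<in> U i) \<longrightarrow> S q = S p)" if "p \<in> PiE {..<2 * m} cell" for p
  proof -
    \<comment> \<open>The open set of those unions that behave towards \<open>E\<close> as
      \<open>g (segments m p)\<close> does.\<close>
    define A where "A = (if S p then {G \<in> interval_unions m. G \<subseteq> E}
      else {G \<in> interval_unions m. G \<inter> - E \<noteq> {}})"
    have "openin ?X A"
      unfolding A_def using openin_interval_union_space_subset[OF E(1)]
        openin_interval_union_space_meets[OF E(2)] by simp
    then have op: "openin ?X {G \<in> interval_unions m. g G \<in> A}"
      using openin_continuous_map_preimage[OF g] by (simp add: topspace_interval_union_space)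
    have p: "p \<in> box m" using that by (simp add: box_def)
    have A_iff: "g (segments m q) \<in> A \<longleftrightarrow> S q = S p" if "q \<in> box m" for q
      using g_in[OF segments_in_interval_unions[OF that m]] by (auto simp: A_def S_def)
    have "segments m p \<in> {G \<in> interval_unions m. g G \<in> A}"
      using A_iff[OF p] segments_in_interval_unions[OF p m] by simp
    from segments_continuous[OF op this p m] obtain U where
      U: "\<forall>i<2 * m. open (U i) \<and> p i \<in> U i"
      "\<forall>q\<in>box m. (\<forall>i<2 * m. q i \<in> U i) \<longrightarrow> segments m q \<in> {G \<in> interval_unions m. g G \<in> A}"
      by blast
    have "\<forall>q\<in>PiE {..<2 * m} cell. (\<forall>i<2 * m. q i \<in> U i) \<longrightarrow> S q = S p"
    proof (intro ballI impI)
      fix q assume "q \<in> PiE {..<2 * m} cell" "\<forall>i<2 * m. q i \<in> U i"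
      then have "q \<in> box m" "g (segments m q) \<in> A" using U(2) by (simp_all add: box_def)
      then show "S q = S p" using A_iff by simp
    qed
    with U(1) show ?thesis by blast
  qed
  show ?thesis
    using locally_constant_finitely_determined[OF compact_cell loc] by (simp only: S_def box_def)
qed

lemma uncountable_collision:
  assumes "uncountable I" "f ` I \<subseteq> T" "countable T"
  obtains x y where "x \<in> I" "y \<in> I" "x \<noteq> y" "f x = f y"
proof -
  have "countable (f ` I)" using assms countable_subset by blast
  then have "\<not> inj_on f I" using assms(1) countable_image_inj_on by blast
  then show ?thesis using that by (auto simp: inj_on_def)
qed

lemma singleton_not_homeomorphic_to_segments:
  fixes h g :: "double_arrow set \<Rightarrow> double_arrow set"
  assumes m: "m \<ge> 1" and p0: "p0 \<in> box m"
    and maps: "homeomorphic_maps (interval_union_space m) (interval_union_space m) h g"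
    and h0: "h {arrow True 0} = segments m p0"
  shows False
proof -
  let ?X = "interval_union_space m :: double_arrow set topology"
  let ?U = "interval_unions m :: double_arrow set set"
  note top = topspace_interval_union_space[where 'a = double_arrow]
  have h: "continuous_map ?X ?X h" and g: "continuous_map ?X ?X g"
    and gh: "\<And>G. G \<in> ?U \<Longrightarrow> g (h G) = G" and hg: "\<And>G. G \<in> ?U \<Longrightarrow> h (g G) = G"
    using maps by (auto simp: homeomorphic_maps_def top)
  have g_in: "g G \<in> ?U" if "G \<in> ?U" for G
    using continuous_map_image_subset_topspace[OF g] that by (auto simp: top)
  note seg_in = segments_in_interval_unions[OF _ m]
  have single_in: "{z} \<in> ?U" for z
    using interval_in_interval_unions[of z z m] m by simp

  \<comment> \<open>Endpoint vectors of the pairs near the least point\<close>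
  define c where "c = arrow True 0"
  have c: "rv c = 0" "upper c" by (simp_all add: c_def rv_arrow upper_arrow)
  have op_nhd: "openin ?X {G \<in> ?U. h G \<in> segments_nhd m}"
    using openin_continuous_map_preimage[OF h openin_segments_nhd] by (simp add: top)
  have "{c} \<in> {G \<in> ?U. h G \<in> segments_nhd m}"
    using h0 segments_in_segments_nhd[OF p0 m] single_in by (simp add: c_def)
  \<comment> \<open>By continuity of \<open>h\<close> at \<open>{c}\<close>, all members inside
    \<open>V\<close>, and so all pairs over positive values below \<open>r\<close>, are sent into
    the image of the box.\<close>
  from nhds_singleton_interval_union_space[OF op_nhd this] obtain V where V: "open V" "c \<in> V"
    "\<forall>G\<in>?U. G \<subseteq> V \<longrightarrow> G \<in> {G \<in> ?U. h G \<in> segments_nhd m}" .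
  obtain r where r: "r \<in> \<rat>" "c \<in> nb r c" "nb r c \<subseteq> V" using nb_basis[OF V(1,2)] .
  then have "r > 0" using c by (simp add: nb_def)

  define I where "I = {0<..<min r 1} - \<rat>"
  have "uncountable I"
    unfolding I_def using \<open>r > 0\<close> countable_rat
    by (intro uncountable_minus_countable) (auto simp: uncountable_open_interval)
  have I: "0 < x" "x < 1" "x < r" "x \<notin> \<rat>" if "x \<in> I" for x
    using that by (auto simp: I_def)
  have arr [simp]: "rv (arrow b x) = x" "upper (arrow b x) \<longleftrightarrow> b" if "x \<in> I" for b x
    using I[OF that] by (simp_all add: rv_arrow upper_arrow)

  define pair where "pair x = {arrow False x, arrow True x}" for x
  have pair_in: "pair x \<in> ?U" if x: "x \<in> I" for x
  proof -
    have "pair x = {arrow False x..arrow True x}"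
      using x by (auto simp: pair_def arrow_le_iff arrow_eq_iff)
    moreover have "arrow False x \<le> arrow True x" using x by (simp add: arrow_le_iff)
    ultimately show ?thesis using interval_in_interval_unions m by simp
  qed
  have "\<forall>x\<in>I. \<exists>p. p \<in> box m \<and> h (pair x) = segments m p"
  proof
    fix x assume x: "x \<in> I"
    have "pair x \<subseteq> nb r c"
      using x I[OF x] c by (auto simp: pair_def nb_def cone_def arrow_le_iff)
    then have "h (pair x) \<in> segments_nhd m" using V(3)[rule_format, OF pair_in[OF x]] r(3) by auto
    then show "\<exists>p. p \<in> box m \<and> h (pair x) = segments m p" using segments_nhd_subset by blast
  qed
  from bchoice[OF this] obtain p where
    p: "\<And>x. x \<in> I \<Longrightarrow> p x \<in> box m" "\<And>x. x \<in> I \<Longrightarrow> h (pair x) = segments m (p x)" by blast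
  have g_p: "g (segments m (p x)) = pair x" if "x \<in> I" for x
    using gh[OF pair_in[OF that]] p(2)[OF that] by simp

  \<comment> \<open>Preimages of the flipped vectors\<close>
  define \<E> where "\<E> = (\<lambda>(b, q). cone (arrow b q)) ` (UNIV \<times> (\<rat> \<inter> {0<..<1}))"
  \<comment> \<open>The complement of a ray in \<open>\<E>\<close> is again a cone, so these rays
    are clopen. They are countably many, yet separate any two points with different real
    values.\<close>
  have cone_compl: "- cone (arrow b q) = cone (arrow (\<not> b) q)" if "q \<in> {0<..<1}" for b q
    using that by (cases b) (auto simp: cone_def rv_arrow upper_arrow arrow_le_iff arrow_less_iff)
  have "\<forall>E\<in>\<E>. \<exists>Q. finite Q \<and> (\<forall>p\<in>box m. \<forall>q\<in>box m.
      (\<forall>i<2 * m. rv (p i) = rv (q i) \<and> (rv (p i) \<in> Q \<longrightarrow> p i = q i)) \<longrightarrow>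
      (g (segments m p) \<subseteq> E \<longleftrightarrow> g (segments m q) \<subseteq> E))"
  proof
    fix E assume "E \<in> \<E>"
    then obtain b q where "E = cone (arrow b q)" "q \<in> {0<..<1}" by (auto simp: \<E>_def)
    then have "open E" "open (- E)" using cone_compl open_cone by simp_all
    then show "\<exists>Q. finite Q \<and> (\<forall>p\<in>box m. \<forall>q\<in>box m.
      (\<forall>i<2 * m. rv (p i) = rv (q i) \<and> (rv (p i) \<in> Q \<longrightarrow> p i = q i)) \<longrightarrow>
      (g (segments m p) \<subseteq> E \<longleftrightarrow> g (segments m q) \<subseteq> E))"
      by (rule clopen_finitely_determined[OF g m])
  qed
  from bchoice[OF this] obtain QE where QE: "\<forall>E\<in>\<E>. finite (QE E) \<and> (\<forall>p\<in>box m. \<forall>q\<in>box m.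
      (\<forall>i<2 * m. rv (p i) = rv (q i) \<and> (rv (p i) \<in> QE E \<longrightarrow> p i = q i)) \<longrightarrow>
      (g (segments m p) \<subseteq> E \<longleftrightarrow> g (segments m q) \<subseteq> E))" ..

  \<comment> \<open>Besides the exceptional values of all rays, \<open>Q\<close> contains 0 and 1,
    so that flips exist, and the grid, so that flips stay in their cells.\<close>
  define Q where "Q = (\<Union>E\<in>\<E>. QE E) \<union> {0, 1} \<union> range grid"
  have Q01: "{0, 1} \<subseteq> Q" and Qgrid: "range grid \<subseteq> Q" by (auto simp: Q_def)
  have "countable \<E>" unfolding \<E>_def using countable_rat by (intro countable_image countable_SIGMA) auto
  then have "countable Q" unfolding Q_def using QE by (auto intro: countable_finite)

  define fp where "fp x = (\<lambda>i\<in>{..<2 * m}. flip Q (p x i))" for x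
  have fp_nth: "fp x i = flip Q (p x i)" if "i < 2 * m" for x i using that by (simp add: fp_def)
  have fp: "fp x \<in> box m" if "x \<in> I" for x
    using flip_cell[OF Q01 Qgrid] box_cell[OF p(1)[OF that]] by (simp add: box_def fp_def)

  define G where "G x = g (segments m (fp x))" for x
  have G_in: "G x \<in> ?U" if "x \<in> I" for x
    unfolding G_def using g_in seg_in fp[OF that] by blast
  have h_G: "h (G x) = segments m (fp x)" if "x \<in> I" for x
    unfolding G_def using hg seg_in fp[OF that] by blast
  \<comment> \<open>A flip moves only coordinates with values outside \<open>Q\<close>, and no ray
    of \<open>\<E>\<close> detects such a move.\<close>
  have same: "G x \<subseteq> E \<longleftrightarrow> pair x \<subseteq> E" if x: "x \<in> I" and E: "E \<in> \<E>" for x E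
  proof -
    have "QE E \<subseteq> Q" using E by (auto simp: Q_def)
    then have "\<forall>i<2 * m. rv (p x i) = rv (fp x i) \<and> (rv (p x i) \<in> QE E \<longrightarrow> p x i = fp x i)"
      using rv_flip[OF Q01] by (auto simp: fp_nth flip_def subset_iff)
    then show ?thesis
      unfolding G_def g_p[OF x, symmetric] using QE[rule_format, OF E] p(1)[OF x] fp[OF x] by blast
  qed
  \<comment> \<open>The rays of \<open>\<E>\<close> that contain \<open>pair x\<close> intersect in
    \<open>pair x\<close>, and by \<open>same\<close> they all contain \<open>G x\<close>.\<close>
  have G_sub: "G x \<subseteq> pair x" if x: "x \<in> I" for x
  proof
    fix z assume z: "z \<in> G x"
    have "\<not> x < rv z"
    proof
      assume "x < rv z"
      then obtain q where q: "x < of_rat q" "of_rat q < rv z" using of_rat_dense by blast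
      have q01: "0 < real_of_rat q" "real_of_rat q < 1" using q I[OF x] rv_bounds(2)[of z] by linarith+
      then have "cone (arrow False (of_rat q)) \<in> \<E>" unfolding \<E>_def by force
      moreover have "pair x \<subseteq> cone (arrow False (of_rat q))"
        using x q q01 by (auto simp: pair_def cone_def rv_arrow upper_arrow arrow_le_iff)
      ultimately have "z \<in> cone (arrow False (of_rat q))" using same[OF x] z by blast
      then show False using q q01 by (auto simp: cone_def rv_arrow upper_arrow arrow_le_iff)
    qed
    moreover have "\<not> rv z < x"
    proof
      assume "rv z < x"
      then obtain q where q: "rv z < of_rat q" "of_rat q < x" using of_rat_dense by blast
      have q01: "0 < real_of_rat q" "real_of_rat q < 1" using q I[OF x] rv_bounds(1)[of z] by linarith+
      then have "cone (arrow True (of_rat q)) \<in> \<E>" unfolding \<E>_def by force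
      moreover have "pair x \<subseteq> cone (arrow True (of_rat q))"
        using x q q01 by (auto simp: pair_def cone_def rv_arrow upper_arrow arrow_le_iff)
      ultimately have "z \<in> cone (arrow True (of_rat q))" using same[OF x] z by blast
      then show False using q q01 by (auto simp: cone_def rv_arrow upper_arrow arrow_le_iff)
    qed
    ultimately have "rv z = x" by linarith
    then show "z \<in> pair x" using x by (auto simp: pair_def arrow_eq_iff)
  qed
  have G_cases: "G x = pair x \<or> G x = {arrow True x} \<or> G x = {arrow False x}" if x: "x \<in> I" for x
    using G_sub[OF x] interval_unions_nonempty[OF G_in[OF x]] by (auto simp: pair_def)

  \<comment> \<open>Isolation before and after the flip\<close>
  define Ob where "Ob x = {G \<in> ?U. G \<inter> cone (arrow True x) \<noteq> {}} \<inter> {G \<in> ?U. G \<inter> cone (arrow False x) \<noteq> {}}" for x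
  \<comment> \<open>Meeting the upper cone forces \<open>y \<ge> x\<close>, meeting the lower one
    forces \<open>y \<le> x\<close>: \<open>Ob x\<close> isolates \<open>pair x\<close> from the
    other pairs.\<close>
  have Ob_pair: "pair y \<in> Ob x \<longleftrightarrow> y = x" if "x \<in> I" "y \<in> I" for x y
    using that pair_in[of y] by (auto simp: Ob_def pair_def cone_def arrow_le_iff)
  \<comment> \<open>Pulled back to vectors, this isolation has rational cutoffs: no
    \<open>p y\<close> with \<open>y \<noteq> x\<close> lies in the product of one-sided
    neighbourhoods around \<open>p x\<close>.\<close>
  have "\<forall>x\<in>I. \<exists>r. (\<forall>i<2 * m. r i \<in> \<rat> \<and> p x i \<in> nb (r i) (p x i)) \<and>
    (\<forall>q\<in>box m. (\<forall>i<2 * m. q i \<in> nb (r i) (p x i)) \<longrightarrow> g (segments m q) \<in> Ob x)"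
  proof
    fix x assume x: "x \<in> I"
    have "openin ?X (Ob x)"
      unfolding Ob_def by (intro openin_Int openin_interval_union_space_meets open_cone)
    then have op: "openin ?X {K \<in> ?U. g K \<in> Ob x}"
      using openin_continuous_map_preimage[OF g] by (simp add: top)
    have "segments m (p x) \<in> {K \<in> ?U. g K \<in> Ob x}"
      using g_p[OF x] Ob_pair[OF x x] seg_in p(1)[OF x] by simp
    from segments_continuous[OF op this p(1)[OF x] m] obtain U where
      U: "\<forall>i<2 * m. open (U i) \<and> p x i \<in> U i"
      "\<forall>q\<in>box m. (\<forall>i<2 * m. q i \<in> U i) \<longrightarrow> segments m q \<in> {K \<in> ?U. g K \<in> Ob x}" by blast
    have "\<forall>i\<in>{..<2 * m}. \<exists>r. r \<in> \<rat> \<and> p x i \<in> nb r (p x i) \<and> nb r (p x i) \<subseteq> U i"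
    proof
      fix i assume "i \<in> {..<2 * m}"
      then have "open (U i)" "p x i \<in> U i" using U(1) by simp_all
      then show "\<exists>r. r \<in> \<rat> \<and> p x i \<in> nb r (p x i) \<and> nb r (p x i) \<subseteq> U i" by (meson nb_basis)
    qed
    from bchoice[OF this] obtain r where
      "\<forall>i\<in>{..<2 * m}. r i \<in> \<rat> \<and> p x i \<in> nb (r i) (p x i) \<and> nb (r i) (p x i) \<subseteq> U i" ..
    then show "\<exists>r. (\<forall>i<2 * m. r i \<in> \<rat> \<and> p x i \<in> nb (r i) (p x i)) \<and>
      (\<forall>q\<in>box m. (\<forall>i<2 * m. q i \<in> nb (r i) (p x i)) \<longrightarrow> g (segments m q) \<in> Ob x)"
      using U(2) by (intro exI[of _ r]) (simp add: subset_iff)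
  qed
  from bchoice[OF this] obtain rr where rr: "\<forall>x\<in>I. (\<forall>i<2 * m. rr x i \<in> \<rat> \<and> p x i \<in> nb (rr x i) (p x i)) \<and>
    (\<forall>q\<in>box m. (\<forall>i<2 * m. q i \<in> nb (rr x i) (p x i)) \<longrightarrow> g (segments m q) \<in> Ob x)" ..

  \<comment> \<open>Continuity of \<open>h\<close> at a singleton \<open>G x\<close>: nearby
    singletons \<open>G y\<close> on the same side have flipped vectors inside the cones of
    \<open>fp x\<close>. These cones give a neighbourhood of \<open>segments m (fp x)\<close> by
    \<open>openin_segments_cones\<close>.\<close>
  have "\<forall>x\<in>I. \<exists>\<rho>. \<rho> \<in> \<rat> \<and> (\<forall>b. G x = {arrow b x} \<longrightarrow> arrow b x \<in> nb \<rho> (arrow b x) \<and>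
    (\<forall>y\<in>I. arrow b y \<in> nb \<rho> (arrow b x) \<longrightarrow> G y = {arrow b y} \<longrightarrow> (\<forall>j<2 * m. fp y j \<in> cone (fp x j))))"
  proof
    fix x assume x: "x \<in> I"
    show "\<exists>\<rho>. \<rho> \<in> \<rat> \<and> (\<forall>b. G x = {arrow b x} \<longrightarrow> arrow b x \<in> nb \<rho> (arrow b x) \<and>
      (\<forall>y\<in>I. arrow b y \<in> nb \<rho> (arrow b x) \<longrightarrow> G y = {arrow b y} \<longrightarrow> (\<forall>j<2 * m. fp y j \<in> cone (fp x j))))"
    proof (cases "\<exists>b. G x = {arrow b x}")
      case False
      \<comment> \<open>If \<open>G x\<close> is the whole pair, nothing is asked of the cutoff, and
        0 is a rational default.\<close>
      then show ?thesis by (intro exI[of _ 0]) auto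
    next
      case True
      then obtain b where b: "G x = {arrow b x}" ..
      have b_unique: "b' = b" if "G x = {arrow b' x}" for b'
        using b that arr(2)[OF x, of b] arr(2)[OF x, of b'] by simp
      obtain M where M: "openin ?X M"
        "\<forall>q\<in>box m. segments m q \<in> M \<longleftrightarrow> (\<forall>j<2 * m. q j \<in> cone (fp x j))"
        using openin_segments_cones[OF m] .
      have op: "openin ?X {K \<in> ?U. h K \<in> M}"
        using openin_continuous_map_preimage[OF h M(1)] by (simp add: top)
      have "segments m (fp x) \<in> M"
        using M(2)[rule_format, OF fp[OF x]] by (simp add: cone_def)
      then have "{arrow b x} \<in> {K \<in> ?U. h K \<in> M}"
        using h_G[OF x] b single_in by simp
      from nhds_singleton_interval_union_space[OF op this] obtain W where W: "open W" "arrow b x \<in> W"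
        "\<forall>K\<in>?U. K \<subseteq> W \<longrightarrow> K \<in> {K \<in> ?U. h K \<in> M}" .
      obtain \<rho> where \<rho>: "\<rho> \<in> \<rat>" "arrow b x \<in> nb \<rho> (arrow b x)" "nb \<rho> (arrow b x) \<subseteq> W"
        using nb_basis[OF W(1,2)] .
      have "\<forall>j<2 * m. fp y j \<in> cone (fp x j)"
        if y: "y \<in> I" "arrow b y \<in> nb \<rho> (arrow b x)" "G y = {arrow b y}" for y
      proof -
        have "G y \<subseteq> W" using subsetD[OF \<rho>(3) y(2)] y(3) by simp
        then have "segments m (fp y) \<in> M" using W(3)[rule_format, OF G_in[OF y(1)]] h_G[OF y(1)] by simp
        then show ?thesis using M(2)[rule_format, OF fp[OF y(1)]] by blast
      qed
      then show ?thesis using \<rho>(1,2) b_unique by (intro exI[of _ \<rho>]) blast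
    qed
  qed
  from bchoice[OF this] obtain \<rho> where \<rho>: "\<forall>x\<in>I. \<rho> x \<in> \<rat> \<and> (\<forall>b. G x = {arrow b x} \<longrightarrow>
    arrow b x \<in> nb (\<rho> x) (arrow b x) \<and> (\<forall>y\<in>I. arrow b y \<in> nb (\<rho> x) (arrow b x) \<longrightarrow> G y = {arrow b y} \<longrightarrow>
      (\<forall>j<2 * m. fp y j \<in> cone (fp x j))))" ..

  \<comment> \<open>Pigeonhole and contradiction\<close>
  define coords where "coords x = map (\<lambda>i. (upper (p x i), rr x i,
    if rv (p x i) \<in> Q then Some (rv (p x i)) else None)) [0..<2 * m]" for x
  \<comment> \<open>The code records countable data only: the side and the cutoff of each endpoint,
    the exact value of the endpoints that do not move, the shape of \<open>G x\<close>, and its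
    cutoff. Two different values must share it.\<close>
  define code where "code x = (coords x, G x = pair x, G x = {arrow True x}, \<rho> x)" for x
  define codes where "codes = lists ((UNIV :: bool set) \<times> (\<rat> :: real set) \<times> insert None (Some ` Q)) \<times>
    (UNIV :: bool set) \<times> (UNIV :: bool set) \<times> (\<rat> :: real set)"
  have "code ` I \<subseteq> codes"
    using rr \<rho> by (auto simp: codes_def code_def coords_def)
  moreover have "countable codes"
    unfolding codes_def using \<open>countable Q\<close>
    by (intro countable_SIGMA countable_lists countable_insert countable_image countableI_type countable_rat)
  ultimately obtain x' y' where "x' \<in> I" "y' \<in> I" "x' \<noteq> y'" "code x' = code y'"
    using uncountable_collision[OF \<open>uncountable I\<close>] by metis
  then obtain x y where xy: "x \<in> I" "y \<in> I" "x < y" and code: "code x = code y"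
    by (cases "x' < y'") auto

  have coords_eq: "upper (p x i) = upper (p y i)" "rr x i = rr y i"
    "rv (p x i) \<in> Q \<or> rv (p y i) \<in> Q \<Longrightarrow> p x i = p y i" if i: "i < 2 * m" for i
  proof -
    have "coords x ! i = coords y ! i" using code by (simp add: code_def)
    then have *: "upper (p x i) = upper (p y i)" "rr x i = rr y i"
      "(if rv (p x i) \<in> Q then Some (rv (p x i)) else None) = (if rv (p y i) \<in> Q then Some (rv (p y i)) else None)"
      using i by (simp_all add: coords_def cong: if_cong)
    show "upper (p x i) = upper (p y i)" "rr x i = rr y i" by (fact *)+
    show "p x i = p y i" if "rv (p x i) \<in> Q \<or> rv (p y i) \<in> Q"
      using * that by (auto simp: arrow_eq_iff split: if_splits)
  qed
  \<comment> \<open>The flip reverses the cones: if \<open>fp v\<close> lies in the cones of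
    \<open>fp u\<close>, then \<open>p u\<close> lies in those of \<open>p v\<close>. As
    \<open>u\<close> and \<open>v\<close> share their cutoffs, \<open>p u\<close> is even in the
    neighbourhoods around \<open>p v\<close>, against the isolation of the pairs.\<close>
  have apart: False
    if uv: "u \<in> {x, y}" "v \<in> {x, y}" "u \<noteq> v" and cones: "\<forall>j<2 * m. fp v j \<in> cone (fp u j)" for u v
  proof -
    have uvI: "u \<in> I" "v \<in> I" using uv xy by auto
    have "p u i \<in> nb (rr v i) (p v i)" if i: "i < 2 * m" for i
    proof (rule flip_cone_imp_nb[OF Q01])
      show "upper (p u i) = upper (p v i)" using uv coords_eq(1)[OF i] by auto
      have "rr v i = rr u i" using uv coords_eq(2)[OF i] by auto
      then show "p u i \<in> nb (rr v i) (p u i)" using rr uvI(1) i by simp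
      show "p u i = p v i" if "rv (p u i) \<in> Q \<or> rv (p v i) \<in> Q"
        using uv coords_eq(3)[OF i] that by auto
      show "flip Q (p v i) \<in> cone (flip Q (p u i))" using cones i by (simp add: fp_nth)
    qed
    then have "g (segments m (p u)) \<in> Ob v" using rr uvI(2) p(1)[OF uvI(1)] by blast
    then show False using g_p[OF uvI(1)] Ob_pair[OF uvI(2,1)] uv(3) by simp
  qed
  have kind: "G x = pair x \<longleftrightarrow> G y = pair y" "G x = {arrow True x} \<longleftrightarrow> G y = {arrow True y}"
    "\<rho> x = \<rho> y"
    using code by (simp_all add: code_def)
  consider "G x = pair x" | "G x = {arrow True x}" "G y = {arrow True y}"
    | "G x = {arrow False x}" "G y = {arrow False y}"
    using G_cases[OF xy(1)] G_cases[OF xy(2)] kind by blast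
  then show False
  proof cases
    \<comment> \<open>Here the flip changed nothing, so all values of \<open>p x\<close> lie in
      \<open>Q\<close>; the common code then gives \<open>p x\<close> and \<open>p y\<close> the
      same coordinates.\<close>
    case 1
    then have "segments m (fp x) = segments m (p x)"
      using h_G[OF xy(1)] p(2)[OF xy(1)] by simp
    then have eq: "fp x = p x"
      using inj_onD[OF inj_on_segments] fp[OF xy(1)] p(1)[OF xy(1)] by blast
    have "fp y j \<in> cone (fp x j)" if j: "j < 2 * m" for j
    proof -
      have "flip Q (p x j) = p x j" using eq fp_nth[OF j, of x] by simp
      then have "rv (p x j) \<in> Q" using upper_flip[OF Q01, of "p x j"] by auto
      then have "p x j = p y j" using coords_eq(3)[OF j] by blast
      then show ?thesis by (simp add: fp_nth[OF j] cone_def)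
    qed
    then show False using apart[of x y] xy by simp
  next
    case 2
    \<comment> \<open>Upper points look to the right, so the larger value \<open>y\<close> is caught
      by the neighbourhood of \<open>x\<close>: the common cutoff lies beyond
      \<open>y\<close>.\<close>
    have "arrow True y \<in> nb (\<rho> y) (arrow True y)" using \<rho> xy(2) 2 by blast
    then have "arrow True y \<in> nb (\<rho> x) (arrow True x)"
      using xy kind(3) by (simp add: nb_def cone_def arrow_le_iff)
    then have "\<forall>j<2 * m. fp y j \<in> cone (fp x j)" using \<rho> xy(1,2) 2 by blast
    then show False using apart[of x y] xy by simp
  next
    case 3
    \<comment> \<open>Lower points look to the left, so \<open>x\<close> and \<open>y\<close>
      exchange their roles.\<close>
    have "arrow False x \<in> nb (\<rho> x) (arrow False x)" using \<rho> xy(1) 3 by blast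
    then have "arrow False x \<in> nb (\<rho> y) (arrow False y)"
      using xy kind(3) by (simp add: nb_def cone_def arrow_le_iff)
    then have "\<forall>j<2 * m. fp x j \<in> cone (fp y j)" using \<rho> xy(1,2) 3 by blast
    then show False using apart[of y x] xy by simp
  qed
qed

theorem theorem1p3:
  fixes m :: nat
  assumes "m \<ge> 1"
  shows "\<not> homogeneous_space (interval_union_space m :: double_arrow set topology)"
proof
  let ?X = "interval_union_space m :: double_arrow set topology"
  assume hom: "homogeneous_space ?X"
  \<comment> \<open>A concrete vector of the box gives a target point to which
    \<open>singleton_not_homeomorphic_to_segments\<close> applies.\<close>
  define p where "p = (\<lambda>j\<in>{..<2 * m}. left_end j)"
  have p: "p \<in> box m"
    by (simp add: box_def p_def mem_cell_iff left_end_le_right_end_iff)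
  have "{arrow True 0} \<in> topspace ?X" "segments m p \<in> topspace ?X"
    using interval_in_interval_unions[of "arrow True 0" "arrow True 0" m]
      segments_in_interval_unions[OF p assms] assms
    by (simp_all add: topspace_interval_union_space)
  then obtain h where "homeomorphic_map ?X ?X h" "h {arrow True 0} = segments m p"
    using hom unfolding homogeneous_space_def by blast
  then show False
    using singleton_not_homeomorphic_to_segments[OF assms p] homeomorphic_map_maps by blast
qed

end
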